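(* Let $\{x_n\}_{n\ge 1}$ and $\{y_n\}_{n\ge 1}$ be two sequences of real numbers, with $y_n\neq 0$ for all sufficiently large $n$, such that $\lim_{n\to\infty} x_n/y_n=1$. Suppose that, as $n\to+\infty$, $$\frac{x_n}{y_n}-\frac{x_{n+1}}{y_{n+1}}=\sum_{j=0}^{\infty}\frac{a_j}{n^j},\quad a_0=a_1=0,\qquad x_n=y_n\left(\sum_{j=0}^{\infty}\frac{b_j}{n^j}\right),$$ where $(a_j)_{j\ge 0}$ and $(b_j)_{j\ge 0}$ are real sequences and both expansions are understood as asymptotic power series. Then the coefficients $b_j$ are given by the recursive formula $$b_0=1,\qquad b_k=\frac{1}{k}\left(a_{k+1}-\sum_{j=1}^{k-1}(-1)^{j+k}\binom{k}{j-1}b_j\right),\quad k=1,2,3,\ldots$$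
   Context: An expansion $u_n=\sum_{j=0}^{\infty}\frac{a_j}{n^j}$ as $n\to+\infty$ is an asymptotic power series: for every integer $m\ge 0$, $u_n=\sum_{j=0}^{m}\frac{a_j}{n^j}+o\left(\frac{1}{n^m}\right)$ as $n\to\infty$ (convergence of the infinite series is not required). The relation $x_n=y_n\left(\sum_{j=0}^{\infty}\frac{b_j}{n^j}\right)$ means that $x_n/y_n$ has the asymptotic power series $\sum_{j=0}^{\infty}\frac{b_j}{n^j}$. Empty sums are $0$. *)

theory Defs
  imports Complex_Main "HOL-Library.Landau_Symbols"
begin

text \<open>
  \<open>u\<close> has the asymptotic power series with coefficients \<open>c\<close> in \<open>1/n\<close> as \<open>n\<close> tends to infinity.
  Convergence of the infinite series is not required.  The value at \<open>n = 0\<close>, where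
  \<open>c j / 0 ^ j\<close> is a junk value for \<open>j > 0\<close>, does not affect the asymptotics.
\<close>

definition asymp_power_series :: "(nat \<Rightarrow> real) \<Rightarrow> (nat \<Rightarrow> real) \<Rightarrow> bool" where
  "asymp_power_series u c \<longleftrightarrow>
     (\<forall>m. (\<lambda>n. u n - (\<Sum>j=0..m. c j / real n ^ j)) \<in> o[at_top](\<lambda>n. 1 / real n ^ m))"

end

theory Submission
  imports Defs
begin

text \<open>
  Write \<open>u n = x n / y n\<close>. The idea is to compute the asymptotic power series of
  \<open>u n - u (n + 1)\<close> from that of \<open>u\<close> and to compare it with the given coefficients \<open>a\<close>,
  which is legitimate because a sequence determines its coefficients
  (\<open>asymp_power_series_unique\<close>).

  The shifted sequence is expanded by re-expanding each \<open>1 / (n + 1) ^ j\<close> in powers of \<open>1 / n\<close>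
  (\<open>asymp_power_series_inverse_Suc_power\<close>): for \<open>j \<ge> 1\<close>, the binomial series of
  \<open>n ^ (-j) * (1 + 1 / n) ^ (-j)\<close> contributes \<open>(-1) ^ (j - 1 + k) * (k choose (j - 1))\<close> at
  \<open>1 / n ^ (k + 1)\<close>. The resulting coefficient matrix is triangular, so that each coefficient of
  the shifted series (\<open>asymp_power_series_shift\<close>) is a finite sum. At \<open>1 / n ^ (k + 1)\<close> the term
  \<open>b (k + 1)\<close> occurs with factor \<open>1\<close> and cancels in \<open>u n - u (n + 1)\<close>, while \<open>b k\<close> occurs with
  factor \<open>-k\<close> in the series of \<open>u (n + 1)\<close>; solving for \<open>b k\<close> gives the recursion. Finally,
  \<open>b 0\<close> is the limit of \<open>u\<close>.
\<close>

lemma asymp_power_series_diff: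
  assumes "asymp_power_series u c" and "asymp_power_series v d"
  shows "asymp_power_series (\<lambda>n. u n - v n) (\<lambda>k. c k - d k)"
  unfolding asymp_power_series_def
proof
  fix m
  have "(\<lambda>n. (u n - (\<Sum>j=0..m. c j / real n ^ j)) - (v n - (\<Sum>j=0..m. d j / real n ^ j)))
          \<in> o(\<lambda>n. 1 / real n ^ m)"
    using assms unfolding asymp_power_series_def by - (rule sum_in_smallo(2); blast)
  then show "(\<lambda>n. u n - v n - (\<Sum>j=0..m. (c j - d j) / real n ^ j)) \<in> o(\<lambda>n. 1 / real n ^ m)"
    by (simp add: diff_divide_distrib sum_subtractf algebra_simps)
qed

text \<open>
  If all coefficients before \<open>c m\<close> vanish, the expansion to order \<open>m\<close> says that
  \<open>c m / n ^ m\<close> is negligible against \<open>1 / n ^ m\<close>.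
\<close>

lemma asymp_power_series_zero_coeff:
  assumes "asymp_power_series (\<lambda>n. 0) c"
  shows "c m = 0"
proof (induction m rule: less_induct)
  case (less m)
  have "(\<Sum>j=0..m. c j / real n ^ j) = c m / real n ^ m" for n
    using less by (subst sum.remove[of _ m]) auto
  moreover have "(\<lambda>n. 0 - (\<Sum>j=0..m. c j / real n ^ j)) \<in> o(\<lambda>n. 1 / real n ^ m)"
    using assms unfolding asymp_power_series_def by blast
  ultimately have "(\<lambda>n. c m / real n ^ m) \<in> o(\<lambda>n. 1 / real n ^ m)"
    by simp
  then have "((\<lambda>n. (c m / real n ^ m) / (1 / real n ^ m)) \<longlongrightarrow> 0) sequentially"
    by (rule smalloD_tendsto)
  moreover have "eventually (\<lambda>n. (c m / real n ^ m) / (1 / real n ^ m) = c m) sequentially"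
    using eventually_gt_at_top[of 0] by eventually_elim auto
  ultimately have "((\<lambda>n::nat. c m) \<longlongrightarrow> 0) sequentially"
    using tendsto_cong by force
  then show ?case
    by (simp add: tendsto_const_iff)
qed

lemma asymp_power_series_unique:
  assumes "asymp_power_series u c" and "asymp_power_series u d"
  shows "c = d"
  using asymp_power_series_zero_coeff[of "\<lambda>k. c k - d k"]
    asymp_power_series_diff[OF assms] by auto

lemma asymp_power_series_imp_tendsto:
  assumes "asymp_power_series u c"
  shows "u \<longlonglongrightarrow> c 0"
proof -
  have "(\<lambda>n. u n - (\<Sum>j=0..0. c j / real n ^ j)) \<in> o(\<lambda>n. 1 / real n ^ 0)"
    using assms unfolding asymp_power_series_def by blast
  then have "(\<lambda>n. u n - c 0) \<longlonglongrightarrow> 0"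
    by (auto dest: smalloD_tendsto)
  then show ?thesis
    by (simp add: LIM_zero_iff)
qed

text \<open>
  Since \<open>(1 + 1 / n) * (u n / (n + 1)) = u n / n\<close>, a series for \<open>u n / (n + 1)\<close> must have
  coefficients \<open>d\<close> with \<open>d (k + 1) + d k = c k\<close>. Conversely, truncating such a series at order
  \<open>m\<close> leaves, besides the remainder of \<open>u\<close>, only the boundary term \<open>d (m + 1) / n ^ m\<close>; both are
  made negligible by the factor \<open>1 / (n + 1)\<close>.
\<close>

lemma asymp_power_series_divide_Suc:
  assumes u: "asymp_power_series u c"
    and d0: "d 0 = 0" and d_Suc: "\<And>k. d (Suc k) + d k = c k"
  shows "asymp_power_series (\<lambda>n. u n / real (Suc n)) d"
  unfolding asymp_power_series_def
proof
  fix m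
  define r where "r n = u n - (\<Sum>j=0..m. c j / real n ^ j) + d (Suc m) / real n ^ m" for n
  have trunc: "(real n + 1) * (\<Sum>j=0..m. d j / real n ^ j)
      = (\<Sum>j=0..m. c j / real n ^ j) - d (Suc m) / real n ^ m" if "n > 0" for n
  proof (induction m)
    case 0
    show ?case using d0 d_Suc[of 0] by simp
  next
    case (Suc m)
    have "c (Suc m) = d (Suc (Suc m)) + d (Suc m)"
      by (simp add: d_Suc)
    with Suc that show ?case
      by (simp add: distrib_left) (simp add: field_simps)
  qed
  have "(\<lambda>n. u n - (\<Sum>j=0..m. c j / real n ^ j)) \<in> O(\<lambda>n. 1 / real n ^ m)"
    using u unfolding asymp_power_series_def by (blast intro: landau_o.small_imp_big)
  moreover have "(\<lambda>n. d (Suc m) / real n ^ m) \<in> O(\<lambda>n. 1 / real n ^ m)"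
    by (intro bigoI[of _ "\<bar>d (Suc m)\<bar>"]) auto
  ultimately have "r \<in> O(\<lambda>n. 1 / real n ^ m)"
    unfolding r_def by (rule sum_in_bigo)
  moreover have "(\<lambda>n. 1 / real (Suc n)) \<in> o(\<lambda>n. 1)"
    using LIMSEQ_inverse_real_of_nat by (intro smalloI_tendsto) (auto simp: inverse_eq_divide)
  ultimately have "(\<lambda>n. r n * (1 / real (Suc n))) \<in> o(\<lambda>n. 1 / real n ^ m * 1)"
    by (rule landau_o.big_small_mult)
  moreover have "eventually (\<lambda>n. r n * (1 / real (Suc n))
      = u n / real (Suc n) - (\<Sum>j=0..m. d j / real n ^ j)) sequentially"
    using eventually_gt_at_top[of 0]
  proof eventually_elim
    case (elim n)
    have "r n = u n - (real n + 1) * (\<Sum>j=0..m. d j / real n ^ j)"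
      using trunc[OF elim] by (simp add: r_def)
    then show ?case
      by (simp add: field_simps)
  qed
  ultimately show "(\<lambda>n. u n / real (Suc n) - (\<Sum>j=0..m. d j / real n ^ j))
      \<in> o(\<lambda>n. 1 / real n ^ m)"
    by (simp add: landau_o.small.in_cong)
qed

text \<open>
  \<open>shift_coeff j k\<close> is the coefficient of \<open>z ^ k\<close> in the binomial series of
  \<open>(z / (1 + z)) ^ j\<close>, that is, of \<open>1 / (n + 1) ^ j\<close> under \<open>z = 1 / n\<close>.
\<close>

fun shift_coeff :: "nat \<Rightarrow> nat \<Rightarrow> real" where
  "shift_coeff 0 k = (if k = 0 then 1 else 0)"
| "shift_coeff (Suc i) 0 = 0"
| "shift_coeff (Suc i) (Suc k) = (-1) ^ (i + k) * real (k choose i)"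

text \<open>Pascal's rule is exactly the recursion for division by \<open>n + 1\<close>.\<close>

lemma shift_coeff_pascal:
  "shift_coeff (Suc j) (Suc k) + shift_coeff (Suc j) k = shift_coeff j k"
  by (cases j; cases k) (auto simp: algebra_simps)

lemma shift_coeff_eq_0: "k < j \<Longrightarrow> shift_coeff j k = 0"
  by (cases j; cases k) auto

lemma asymp_power_series_inverse_Suc_power:
  "asymp_power_series (\<lambda>n. 1 / real (Suc n) ^ j) (shift_coeff j)"
proof (induction j)
  case 0
  have "(\<Sum>j=0..m. shift_coeff 0 j / real n ^ j) = 1" for m n
    by (subst sum.remove[of _ 0]) auto
  then show ?case
    by (simp add: asymp_power_series_def)
next
  case (Suc j)
  from asymp_power_series_divide_Suc[OF Suc, of "shift_coeff (Suc j)"]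
  show ?case
    using shift_coeff_pascal[of j] by (simp add: mult.commute)
qed

text \<open>
  The remainder of order \<open>m\<close> at \<open>n + 1\<close> is still negligible against \<open>1 / n ^ m\<close>, and the
  finitely many retained terms \<open>c j / (n + 1) ^ j\<close> are expanded one by one.
\<close>

lemma asymp_power_series_shift:
  assumes "asymp_power_series u c"
  shows "asymp_power_series (\<lambda>n. u (Suc n)) (\<lambda>k. \<Sum>j=0..k. c j * shift_coeff j k)"
  unfolding asymp_power_series_def
proof
  fix m
  have "(\<lambda>n. u n - (\<Sum>j=0..m. c j / real n ^ j)) \<in> o(\<lambda>n. 1 / real n ^ m)"
    using assms unfolding asymp_power_series_def by blast
  then have "(\<lambda>n. u (Suc n) - (\<Sum>j=0..m. c j / real (Suc n) ^ j))
      \<in> o(\<lambda>n. 1 / real (Suc n) ^ m)"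
    by (rule landau_o.small.compose[OF _ filterlim_Suc])
  moreover have "(\<lambda>n. 1 / real (Suc n) ^ m) \<in> O(\<lambda>n. 1 / real n ^ m)"
  proof (rule bigoI[of _ 1])
    show "eventually (\<lambda>n. norm (1 / real (Suc n) ^ m) \<le> 1 * norm (1 / real n ^ m)) sequentially"
      using eventually_gt_at_top[of 0]
      by eventually_elim (auto intro!: divide_left_mono power_mono simp del: of_nat_Suc)
  qed
  ultimately have remainder: "(\<lambda>n. u (Suc n) - (\<Sum>j=0..m. c j / real (Suc n) ^ j))
      \<in> o(\<lambda>n. 1 / real n ^ m)"
    by (rule landau_o.small_big_trans)
  have terms: "(\<lambda>n. \<Sum>j=0..m. c j * (1 / real (Suc n) ^ j
        - (\<Sum>k=0..m. shift_coeff j k / real n ^ k))) \<in> o(\<lambda>n. 1 / real n ^ m)"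
    using asymp_power_series_inverse_Suc_power unfolding asymp_power_series_def
    by (intro big_sum_in_smallo landau_o.small.cmult_in_iff'[THEN iffD2] impI) auto
  have "(\<Sum>j=0..m. c j * (\<Sum>k=0..m. shift_coeff j k / real n ^ k))
      = (\<Sum>k=0..m. (\<Sum>j=0..k. c j * shift_coeff j k) / real n ^ k)" for n
  proof -
    have "(\<Sum>j=0..m. c j * (\<Sum>k=0..m. shift_coeff j k / real n ^ k))
        = (\<Sum>k=0..m. (\<Sum>j=0..m. c j * shift_coeff j k) / real n ^ k)"
      by (simp add: sum_distrib_left sum_divide_distrib) (rule sum.swap)
    also have "(\<Sum>j=0..m. c j * shift_coeff j k) = (\<Sum>j=0..k. c j * shift_coeff j k)"
      if "k \<le> m" for k
      using that by (intro sum.mono_neutral_right) (auto simp: shift_coeff_eq_0)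
    then have "(\<Sum>k=0..m. (\<Sum>j=0..m. c j * shift_coeff j k) / real n ^ k)
        = (\<Sum>k=0..m. (\<Sum>j=0..k. c j * shift_coeff j k) / real n ^ k)"
      by (intro sum.cong) auto
    finally show ?thesis .
  qed
  with sum_in_smallo(1)[OF remainder terms]
  show "(\<lambda>n. u (Suc n) - (\<Sum>k=0..m. (\<Sum>j=0..k. c j * shift_coeff j k) / real n ^ k))
      \<in> o(\<lambda>n. 1 / real n ^ m)"
    by (simp add: right_diff_distrib sum_subtractf del: of_nat_Suc)
qed

theorem theorem3p1:
  fixes x y a b :: "nat \<Rightarrow> real"
  assumes y_nz: "eventually (\<lambda>n. y n \<noteq> 0) sequentially"
    and ratio_lim: "(\<lambda>n. x n / y n) \<longlonglongrightarrow> 1"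
    and diff_series: "asymp_power_series (\<lambda>n. x n / y n - x (n + 1) / y (n + 1)) a"
    and a0: "a 0 = 0" and a1: "a 1 = 0"
    and ratio_series: "asymp_power_series (\<lambda>n. x n / y n) b"
  shows "b 0 = 1 \<and>
    (\<forall>k\<ge>1. b k = 1 / real k *
       (a (k + 1) - (\<Sum>j=1..k - 1. (-1) ^ (j + k) * real (k choose (j - 1)) * b j)))"
proof (intro conjI allI impI)
  show "b 0 = 1"
    using asymp_power_series_imp_tendsto[OF ratio_series] ratio_lim by (rule LIMSEQ_unique)
next
  fix k :: nat
  assume "k \<ge> 1"
  then obtain l where k: "k = Suc l"
    by (cases k) auto
  have "asymp_power_series (\<lambda>n. x n / y n - x (n + 1) / y (n + 1))
      (\<lambda>k. b k - (\<Sum>j=0..k. b j * shift_coeff j k))"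
    using asymp_power_series_diff[OF ratio_series asymp_power_series_shift[OF ratio_series]]
    by simp
  then have "a = (\<lambda>k. b k - (\<Sum>j=0..k. b j * shift_coeff j k))"
    using diff_series asymp_power_series_unique by blast
  then have "a (Suc k) = b (Suc k) - (\<Sum>j=0..Suc k. b j * shift_coeff j (Suc k))"
    by simp
  \<comment> \<open>The term \<open>j = 0\<close> vanishes; the last two terms are split off.\<close>
  also have "(\<Sum>j=0..Suc k. b j * shift_coeff j (Suc k))
      = (\<Sum>j=1..l. b j * shift_coeff j (Suc k)) - real k * b k + b (Suc k)"
    by (simp add: k sum.atLeast_Suc_atMost[of 0] algebra_simps flip: mult_2 power_add)
  also have "(\<Sum>j=1..l. b j * shift_coeff j (Suc k))
      = - (\<Sum>j=1..l. (-1) ^ (j + k) * real (k choose (j - 1)) * b j)"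
    unfolding sum_negf[symmetric]
  proof (rule sum.cong)
    fix j assume "j \<in> {1..l}"
    then obtain i where "j = Suc i"
      by (cases j) auto
    then show "b j * shift_coeff j (Suc k) = - ((-1) ^ (j + k) * real (k choose (j - 1)) * b j)"
      by simp
  qed simp
  finally have "real k * b k
      = a (k + 1) - (\<Sum>j=1..k - 1. (-1) ^ (j + k) * real (k choose (j - 1)) * b j)"
    by (simp add: k)
  with \<open>k \<ge> 1\<close> show "b k = 1 / real k *
      (a (k + 1) - (\<Sum>j=1..k - 1. (-1) ^ (j + k) * real (k choose (j - 1)) * b j))"
    by (simp add: field_simps)
qed

end
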